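(* Let $G=(V,E,\nu,\mu)$ be a weighted graph, let $\Omega$ be a finite connected subset of $V$, and let $p\in(1,\infty)$. Let $f\in\mathbb{R}^\Omega$ be an eigenfunction of the Dirichlet $p$-Laplacian on $\Omega$. Then $f$ is a first eigenfunction if and only if either $f>0$ on $\Omega$ or $f<0$ on $\Omega$. Moreover, the first eigenfunction is unique up to multiplication by constants.
   Context: A weighted graph $G=(V,E,\nu,\mu)$ consists of a locally finite, simple, undirected graph $(V,E)$, an edge weight $\mu:E\to(0,\infty)$, $\{x,y\}\mapsto\mu_{xy}=\mu_{yx}$, extended by $\mu_{xy}=0$ if $\{x,y\}\notin E$, and a vertex measure $\nu:V\to(0,\infty)$, $x\mapsto\nu_x$. Write $x\sim y$ if $\{x,y\}\in E$. Subsets $\Omega\subset V$ are nonempty; a finite $\Omega$ is connected if the subgraph induced on $\Omega$ is connected. $\mathbb{R}^\Omega$ is the set of functions $\Omega\to\mathbb{R}$; for $u\in\mathbb{R}^\Omega$, $\bar u\in\mathbb{R}^V$ is the null-extension ($\bar u=u$ on $\Omega$, $\bar u=0$ on $V\setminus\Omega$). For $p\in(1,\infty)$ the Dirichlet $p$-Laplacian on $\Omega$ is $$\Delta_p u(x)=\frac1{\nu_x}\sum_{y\in V}\mu_{xy}|\bar u(y)-\bar u(x)|^{p-2}(\bar u(y)-\bar u(x)),\quad x\in\Omega,$$ with the convention $|0|^{p-2}0=0$. A function $f\in\mathbb{R}^\Omega$, $f\not\equiv0$, is an eigenfunction pertaining to the eigenvalue $\lambda\in\mathbb{R}$ if $\Delta_p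 f=-\lambda|f|^{p-2}f$ on $\Omega$. Let $E_p(u)=\frac12\sum_{x,y\in V,\,x\sim y}|\bar u(y)-\bar u(x)|^p\mu_{xy}$ (sum over ordered pairs) and $\|u\|_{p,\Omega}^p=\sum_{x\in\Omega}|u(x)|^p\nu_x$. The first (smallest) eigenvalue is $\lambda_{1,p}(\Omega)=\inf_{u\in\mathbb{R}^\Omega,u\not\equiv0}E_p(u)/\|u\|_{p,\Omega}^p$. A first eigenfunction is an eigenfunction pertaining to $\lambda_{1,p}(\Omega)$. *)

theory Defs
  imports "HOL-Analysis.Analysis"
begin

record 'a wgraph =
  verts :: "'a set"
  edges :: "'a set set"
  vmeas :: "'a \<Rightarrow> real"
  emeas :: "'a set \<Rightarrow> real"

definition adj :: "'a wgraph \<Rightarrow> 'a \<Rightarrow> 'a \<Rightarrow> bool" where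
  "adj G x y \<longleftrightarrow> {x, y} \<in> edges G"

text \<open>Edges are two-element sets of vertices, so loops and multiple edges are excluded. The fields
  \<^term>\<open>vmeas\<close> and \<^term>\<open>emeas\<close> are relevant only on vertices and edges, respectively.\<close>

locale weighted_graph =
  fixes G :: "'a wgraph"
  assumes edge_subset: "e \<in> edges G \<Longrightarrow> e \<subseteq> verts G"
    and edge_card: "e \<in> edges G \<Longrightarrow> card e = 2"
    and locally_finite: "x \<in> verts G \<Longrightarrow> finite {y \<in> verts G. adj G x y}"
    and vmeas_pos: "x \<in> verts G \<Longrightarrow> vmeas G x > 0"
    and emeas_pos: "e \<in> edges G \<Longrightarrow> emeas G e > 0"

definition weight :: "'a wgraph \<Rightarrow> 'a \<Rightarrow> 'a \<Rightarrow> real" where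
  "weight G x y = (if adj G x y then emeas G {x, y} else 0)"

definition induced_connected :: "'a wgraph \<Rightarrow> 'a set \<Rightarrow> bool" where
  "induced_connected G \<Omega> \<longleftrightarrow>
     (\<forall>x\<in>\<Omega>. \<forall>y\<in>\<Omega>. (x, y) \<in> {(a, b). a \<in> \<Omega> \<and> b \<in> \<Omega> \<and> adj G a b}\<^sup>*)"

text \<open>A function on \<^term>\<open>\<Omega>\<close> is represented by a total function whose values outside
  \<^term>\<open>\<Omega>\<close> are ignored: every notion below depends only on the values on \<^term>\<open>\<Omega>\<close>.\<close>

definition null_ext :: "'a set \<Rightarrow> ('a \<Rightarrow> real) \<Rightarrow> 'a \<Rightarrow> real" where
  "null_ext \<Omega> u x = (if x \<in> \<Omega> then u x else 0)"

definition nonzero_on :: "'a set \<Rightarrow> ('a \<Rightarrow> real) \<Rightarrow> bool" where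
  "nonzero_on \<Omega> u \<longleftrightarrow> (\<exists>x\<in>\<Omega>. u x \<noteq> 0)"

text \<open>The convention at \<^term>\<open>t = 0\<close> is built in, as the second factor vanishes there.\<close>

definition signed_pow :: "real \<Rightarrow> real \<Rightarrow> real" where
  "signed_pow p t = \<bar>t\<bar> powr (p - 2) * t"

text \<open>The vertex set may be infinite, hence the unordered sums \<^term>\<open>infsum\<close> (a plain
  \<^term>\<open>sum\<close> over an infinite set is 0). By local finiteness, and finiteness of \<^term>\<open>\<Omega>\<close> in the
  case of the energy, only finitely many summands are nonzero.\<close>

definition p_laplacian :: "'a wgraph \<Rightarrow> 'a set \<Rightarrow> real \<Rightarrow> ('a \<Rightarrow> real) \<Rightarrow> 'a \<Rightarrow> real" where
  "p_laplacian G \<Omega> p u x =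
     1 / vmeas G x *
     (\<Sum>\<^sub>\<infinity>y\<in>verts G. weight G x y * signed_pow p (null_ext \<Omega> u y - null_ext \<Omega> u x))"

definition p_energy :: "'a wgraph \<Rightarrow> 'a set \<Rightarrow> real \<Rightarrow> ('a \<Rightarrow> real) \<Rightarrow> real" where
  "p_energy G \<Omega> p u =
     1 / 2 * (\<Sum>\<^sub>\<infinity>(x, y)\<in>{(x, y). x \<in> verts G \<and> y \<in> verts G \<and> adj G x y}.
       \<bar>null_ext \<Omega> u y - null_ext \<Omega> u x\<bar> powr p * weight G x y)"

definition p_norm_pow :: "'a wgraph \<Rightarrow> 'a set \<Rightarrow> real \<Rightarrow> ('a \<Rightarrow> real) \<Rightarrow> real" where
  "p_norm_pow G \<Omega> p u = (\<Sum>x\<in>\<Omega>. \<bar>u x\<bar> powr p * vmeas G x)"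

definition first_eigenvalue :: "'a wgraph \<Rightarrow> 'a set \<Rightarrow> real \<Rightarrow> real" where
  "first_eigenvalue G \<Omega> p =
     (INF u\<in>{u. nonzero_on \<Omega> u}. p_energy G \<Omega> p u / p_norm_pow G \<Omega> p u)"

definition eigenfunction ::
    "'a wgraph \<Rightarrow> 'a set \<Rightarrow> real \<Rightarrow> real \<Rightarrow> ('a \<Rightarrow> real) \<Rightarrow> bool" where
  "eigenfunction G \<Omega> p lam f \<longleftrightarrow>
     nonzero_on \<Omega> f \<and> (\<forall>x\<in>\<Omega>. p_laplacian G \<Omega> p f x = - lam * signed_pow p (f x))"

definition first_eigenfunction :: "'a wgraph \<Rightarrow> 'a set \<Rightarrow> real \<Rightarrow> ('a \<Rightarrow> real) \<Rightarrow> bool" where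
  "first_eigenfunction G \<Omega> p f \<longleftrightarrow> eigenfunction G \<Omega> p (first_eigenvalue G \<Omega> p) f"

end

theory Submission
  imports Defs
begin

text \<open>
  First eigenfunctions are exactly the minimizers of the Rayleigh quotient: testing the eigenvalue
  equation with the eigenfunction itself identifies its eigenvalue with its Rayleigh quotient, and
  conversely a minimizer satisfies the Euler--Lagrange equation (\<open>minimizer_eigenfunction\<close>).

  A first eigenfunction \<open>f\<close> has a strict sign. Replacing \<open>f\<close> by \<open>\<bar>f\<bar>\<close> does not increase the
  energy and keeps the norm, so \<open>\<bar>f\<bar>\<close> is again a minimizer and therefore an eigenfunction; by the
  strong minimum principle (\<open>nonneg_eigenfunction_pos\<close>) it has no zeros in the connected domain.
  The energies of \<open>f\<close> and \<open>\<bar>f\<bar>\<close> can only agree if no edge joins values of opposite sign, so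
  connectedness propagates the sign of \<open>f\<close> from one vertex to all others.

  Both the converse and uniqueness rest on a discrete Picone inequality (\<open>picone\<close>,
  \<open>picone_strict\<close>), which is Jensen's inequality for \<open>\<bar>t\<bar>\<^sup>p\<close>. Testing the equation of a positive
  eigenfunction \<open>f\<close> for the eigenvalue \<open>lam\<close> with \<open>u\<^sup>p / f\<^bsup>p - 1\<^esup>\<close>, where \<open>u \<ge> 0\<close>, gives \<open>lam\<close>
  times the norm of \<open>u\<close> on one side, and on the other side a quantity that Picone's inequality
  bounds by the energy of \<open>u\<close>. So \<open>lam\<close> is a lower bound for all Rayleigh quotients, that is,
  \<open>f\<close> is a first eigenfunction. If \<open>u\<close> is a positive first eigenfunction, too, equality holds
  along every edge inside the domain; strict convexity then forces \<open>u / f\<close> to be constant along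
  edges, hence on the connected domain.
\<close>

section \<open>The function \<open>\<bar>t\<bar>\<^sup>p\<close>\<close>

lemma signed_pow_0 [simp]: "signed_pow p 0 = 0"
  by (simp add: signed_pow_def)

lemma signed_pow_minus [simp]: "signed_pow p (- t) = - signed_pow p t"
  by (simp add: signed_pow_def)

lemma signed_pow_mult_self: "signed_pow p t * t = \<bar>t\<bar> powr p"
proof (cases "t = 0")
  case False
  have "\<bar>t\<bar> powr p = \<bar>t\<bar> powr (p - 2) * \<bar>t\<bar> powr 2"
    by (subst powr_add[symmetric]) simp
  then show ?thesis using False by (simp add: signed_pow_def power2_eq_square)
qed simp

lemma signed_pow_nonneg_eq: "t \<ge> 0 \<Longrightarrow> signed_pow p t = t powr (p - 1)"
  by (cases "t = 0") (use powr_add[of t "p - 2" 1] in \<open>simp_all add: signed_pow_def\<close>)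

lemma signed_pow_strict_mono:
  assumes "1 < p" "s < t"
  shows "signed_pow p s < signed_pow p t"
proof -
  consider "0 \<le> s" | "s < 0" "0 < t" | "t \<le> 0" by linarith
  then show ?thesis
  proof cases
    case 1
    then show ?thesis using assms by (simp add: signed_pow_nonneg_eq powr_less_mono2)
  next
    case 2
    then have "signed_pow p s < 0" "signed_pow p t > 0"
      by (auto simp: signed_pow_def mult_less_0_iff)
    then show ?thesis by linarith
  next
    case 3
    then have "signed_pow p (- t) < signed_pow p (- s)"
      using assms by (subst (1 2) signed_pow_nonneg_eq) (auto intro!: powr_less_mono2)
    then show ?thesis by simp
  qed
qed

lemma has_real_derivative_abs_powr:
  assumes "1 < p"
  shows "((\<lambda>t. \<bar>t\<bar> powr p) has_real_derivative p * signed_pow p t) (at t)"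
proof -
  consider "t > 0" | "t < 0" | "t = 0" by linarith
  then show ?thesis
  proof cases
    case 1
    have "((\<lambda>t. t powr p) has_real_derivative p * signed_pow p t) (at t)"
      using 1 by (auto intro!: derivative_eq_intros simp: signed_pow_nonneg_eq)
    then show ?thesis
      by (rule has_field_derivative_transform_within_open[where S = "{0<..}"]) (use 1 in auto)
  next
    case 2
    have "signed_pow p t = - ((- t) powr (p - 1))"
      using signed_pow_nonneg_eq[of "- t" p] 2 by simp
    then have "((\<lambda>t. (- t) powr p) has_real_derivative p * signed_pow p t) (at t)"
      using 2 by (auto intro!: derivative_eq_intros)
    then show ?thesis
      by (rule has_field_derivative_transform_within_open[where S = "{..<0}"]) (use 2 in auto)
  next
    case 3
    \<comment> \<open>The difference quotient at the origin has absolute value \<open>\<bar>h\<bar> powr (p - 1)\<close>.\<close>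
    have "((\<lambda>h. \<bar>h\<bar> powr (p - 1)) \<longlongrightarrow> \<bar>0\<bar> powr (p - 1)) (at (0::real))"
      using assms by (intro tendsto_intros) (auto intro!: always_eventually)
    then have "((\<lambda>h. \<bar>h\<bar> powr (p - 1)) \<longlongrightarrow> 0) (at (0::real))"
      by simp
    then have "((\<lambda>h. \<bar>h\<bar> powr p / h) \<longlongrightarrow> 0) (at (0::real))"
    proof (rule Lim_null_comparison[rotated])
      have "norm (\<bar>h\<bar> powr p / h) \<le> \<bar>h\<bar> powr (p - 1)" for h :: real
        by (cases "h = 0") (simp_all add: powr_diff)
      then show "\<forall>\<^sub>F h in at (0::real). norm (\<bar>h\<bar> powr p / h) \<le> \<bar>h\<bar> powr (p - 1)"
        by (intro always_eventually) blast
    qed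
    then show ?thesis using 3 by (simp add: DERIV_def)
  qed
qed

text \<open>Strict convexity in tangent form: by the mean value theorem the slope of a secant starting
  at \<^term>\<open>s\<close> is \<^term>\<open>p * signed_pow p z\<close> at an intermediate point, and \<^const>\<open>signed_pow\<close> is
  strictly increasing.\<close>

lemma abs_powr_above_tangent:
  assumes "1 < p" "s \<noteq> t"
  shows "\<bar>s\<bar> powr p + p * signed_pow p s * (t - s) < \<bar>t\<bar> powr p"
proof (cases "s < t")
  case True
  obtain z where z: "s < z" "z < t" "\<bar>t\<bar> powr p - \<bar>s\<bar> powr p = (t - s) * (p * signed_pow p z)"
    using MVT2[OF True, of "\<lambda>t. \<bar>t\<bar> powr p" "\<lambda>z. p * signed_pow p z"]
      has_real_derivative_abs_powr[OF assms(1)] by blast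
  have "(t - s) * (p * signed_pow p s) < (t - s) * (p * signed_pow p z)"
    using signed_pow_strict_mono[OF assms(1) z(1)] True assms(1) by simp
  then show ?thesis using z(3) by (simp add: mult_ac)
next
  case False
  then have "t < s" using assms(2) by simp
  obtain z where z: "t < z" "z < s" "\<bar>s\<bar> powr p - \<bar>t\<bar> powr p = (s - t) * (p * signed_pow p z)"
    using MVT2[OF \<open>t < s\<close>, of "\<lambda>t. \<bar>t\<bar> powr p" "\<lambda>z. p * signed_pow p z"]
      has_real_derivative_abs_powr[OF assms(1)] by blast
  have "(s - t) * (p * signed_pow p z) < (s - t) * (p * signed_pow p s)"
    using signed_pow_strict_mono[OF assms(1) z(2)] \<open>t < s\<close> assms(1) by simp
  then show ?thesis using z(3) by (simp add: algebra_simps)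
qed

text \<open>The two tangent inequalities at the convex combination, weighted so that the linear terms
  cancel.\<close>

lemma abs_powr_strict_convex:
  fixes p \<theta> r s :: real
  assumes "1 < p" "0 < \<theta>" "\<theta> < 1" "r \<noteq> s"
  shows "\<bar>(1 - \<theta>) * r + \<theta> * s\<bar> powr p < (1 - \<theta>) * \<bar>r\<bar> powr p + \<theta> * \<bar>s\<bar> powr p"
proof -
  define m where "m = (1 - \<theta>) * r + \<theta> * s"
  have r: "r - m = \<theta> * (r - s)" and s: "s - m = - ((1 - \<theta>) * (r - s))"
    by (simp_all add: m_def algebra_simps)
  have "r - m \<noteq> 0" "s - m \<noteq> 0" unfolding r s using assms by simp_all
  then have "m \<noteq> r" "m \<noteq> s" by auto
  then have "(1 - \<theta>) * (\<bar>m\<bar> powr p + p * signed_pow p m * (r - m)) < (1 - \<theta>) * \<bar>r\<bar> powr p"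
    and "\<theta> * (\<bar>m\<bar> powr p + p * signed_pow p m * (s - m)) < \<theta> * \<bar>s\<bar> powr p"
    using assms by (auto intro!: mult_strict_left_mono abs_powr_above_tangent)
  moreover have "(1 - \<theta>) * (\<bar>m\<bar> powr p + p * signed_pow p m * (r - m))
      + \<theta> * (\<bar>m\<bar> powr p + p * signed_pow p m * (s - m)) = \<bar>m\<bar> powr p"
    unfolding r s by (simp add: algebra_simps)
  ultimately show ?thesis unfolding m_def by linarith
qed

text \<open>The case \<open>b < a\<close> of the inequality of Picone type below. With \<open>\<theta> = b / a\<close>, multiplying by
  \<open>(1 - \<theta>) powr (1 - p)\<close> turns it into the convexity inequality for
  \<open>c = (1 - \<theta>) * ((c - d) / (1 - \<theta>)) + \<theta> * (d / \<theta>)\<close>; the two points coincide exactly if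
  \<open>c * b = d * a\<close>.\<close>

lemma picone_strict_ordered:
  assumes p: "1 < p" and ab: "0 < b" "b < a" and cd: "0 \<le> c" "0 \<le> d" and ne: "c * b \<noteq> d * a"
  shows "signed_pow p (a - b) * (c powr p / a powr (p - 1) - d powr p / b powr (p - 1))
    < \<bar>c - d\<bar> powr p"
proof -
  define \<theta> where "\<theta> = b / a"
  have \<theta>: "0 < \<theta>" "\<theta> < 1" using ab by (auto simp: \<theta>_def)
  define r s where "r = (c - d) / (1 - \<theta>)" and "s = d / \<theta>"
  have "r \<noteq> s"
  proof
    assume "r = s"
    then have "(c - d) * \<theta> = d * (1 - \<theta>)" using \<theta> by (simp add: r_def s_def field_simps)
    then have "c * \<theta> = d" by (simp add: algebra_simps)
    then show False using ne ab by (simp add: \<theta>_def field_simps)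
  qed
  have c: "c = (1 - \<theta>) * r + \<theta> * s" using \<theta> by (simp add: r_def s_def)
  have conv: "c powr p < (1 - \<theta>) * \<bar>r\<bar> powr p + \<theta> * \<bar>s\<bar> powr p"
    using abs_powr_strict_convex[OF p \<theta> \<open>r \<noteq> s\<close>] cd unfolding c[symmetric] by simp
  define k where "k = (1 - \<theta>) powr (p - 1)"
  have k: "k > 0" using \<theta> by (simp add: k_def)
  have kr: "k * ((1 - \<theta>) * \<bar>r\<bar> powr p) = \<bar>c - d\<bar> powr p"
  proof -
    have "k * (1 - \<theta>) = (1 - \<theta>) powr p"
      using \<theta> powr_add[of "1 - \<theta>" "p - 1" 1] by (simp add: k_def)
    then have "k * ((1 - \<theta>) * \<bar>r\<bar> powr p) = (1 - \<theta>) powr p * \<bar>r\<bar> powr p"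
      by (simp add: mult.assoc[symmetric])
    also have "\<dots> = \<bar>(1 - \<theta>) * r\<bar> powr p" using \<theta> by (simp add: powr_mult abs_mult)
    also have "(1 - \<theta>) * r = c - d" using \<theta> by (simp add: r_def)
    finally show ?thesis .
  qed
  have ks: "\<theta> * \<bar>s\<bar> powr p = d powr p / \<theta> powr (p - 1)"
  proof -
    have "\<theta> powr p = \<theta> powr (p - 1) * \<theta>" using \<theta> powr_add[of \<theta> "p - 1" 1] by simp
    then show ?thesis using \<theta> cd by (simp add: s_def powr_divide)
  qed
  have ka: "signed_pow p (a - b) = k * a powr (p - 1)"
  proof -
    have "a - b = (1 - \<theta>) * a" using ab by (simp add: \<theta>_def field_simps)
    then show ?thesis using \<theta> ab by (simp add: signed_pow_nonneg_eq k_def powr_mult)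
  qed
  have "b = \<theta> * a" using ab by (simp add: \<theta>_def)
  then have b: "b powr (p - 1) = \<theta> powr (p - 1) * a powr (p - 1)"
    using \<theta> ab by (simp add: powr_mult)
  have "signed_pow p (a - b) * (c powr p / a powr (p - 1) - d powr p / b powr (p - 1))
    = k * (c powr p - \<theta> * \<bar>s\<bar> powr p)"
    unfolding ka ks b using ab by (simp add: field_simps)
  also have "\<dots> < k * ((1 - \<theta>) * \<bar>r\<bar> powr p)" using conv k by simp
  finally show ?thesis unfolding kr .
qed

text \<open>The condition \<open>c * b \<noteq> d * a\<close> says that the quotients \<open>c / a\<close> and \<open>d / b\<close> differ; it is the
  exact condition for strictness and so decides the uniqueness of first eigenfunctions.\<close>

lemma picone_strict:
  assumes p: "1 < p" and ab: "0 < a" "0 < b" and cd: "0 \<le> c" "0 \<le> d" and ne: "c * b \<noteq> d * a"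
  shows "signed_pow p (a - b) * (c powr p / a powr (p - 1) - d powr p / b powr (p - 1))
    < \<bar>c - d\<bar> powr p"
proof -
  consider "b < a" | "a < b" | "a = b" by linarith
  then show ?thesis
  proof cases
    case 1
    then show ?thesis using picone_strict_ordered assms by blast
  next
    case 2
    have "signed_pow p (b - a) * (d powr p / b powr (p - 1) - c powr p / a powr (p - 1))
      < \<bar>d - c\<bar> powr p"
      using picone_strict_ordered[OF p ab(1) 2 cd(2,1)] ne by simp
    moreover have "signed_pow p (b - a) = - signed_pow p (a - b)"
      using signed_pow_minus[of p "a - b"] by simp
    ultimately show ?thesis by (simp add: algebra_simps abs_minus_commute)
  next
    case 3
    then show ?thesis using ne by auto
  qed
qed

text \<open>The inequality is also used across the boundary of the domain, where \<^term>\<open>a\<close> or \<^term>\<open>b\<close>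
  vanishes; there, division by zero gives the quotient the value 0.\<close>

lemma picone:
  assumes p: "1 < p" and nonneg: "0 \<le> a" "0 \<le> b" "0 \<le> c" "0 \<le> d"
    and vanish: "a = 0 \<Longrightarrow> c = 0" "b = 0 \<Longrightarrow> d = 0"
  shows "signed_pow p (a - b) * (c powr p / a powr (p - 1) - d powr p / b powr (p - 1))
    \<le> \<bar>c - d\<bar> powr p"
proof -
  consider "a = 0" | "b = 0" | "a > 0" "b > 0" using nonneg by linarith
  then show ?thesis
  proof cases
    case 1
    then show ?thesis using nonneg vanish by (cases "b = 0") (auto simp: signed_pow_nonneg_eq)
  next
    case 2
    then show ?thesis using nonneg vanish by (cases "a = 0") (auto simp: signed_pow_nonneg_eq)
  next
    case 3
    show ?thesis
    proof (cases "c * b = d * a")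
      case True
      \<comment> \<open>Here \<open>c = q * a\<close> and \<open>d = q * b\<close>, and both sides are equal.\<close>
      define q where "q = c / a"
      have q: "q \<ge> 0" "c = q * a" "d = q * b"
        using 3 nonneg True by (auto simp: q_def field_simps)
      have quot: "(q * t) powr p / t powr (p - 1) = q powr p * t" if "t > 0" for t
        using that q powr_add[of t "p - 1" 1] by (simp add: powr_mult field_simps)
      have "signed_pow p (a - b) * (c powr p / a powr (p - 1) - d powr p / b powr (p - 1))
          = q powr p * (signed_pow p (a - b) * (a - b))"
        unfolding q(2,3) quot[OF 3(1)] quot[OF 3(2)] by (simp add: algebra_simps)
      also have "\<dots> = \<bar>q * (a - b)\<bar> powr p"
        using q by (simp add: signed_pow_mult_self abs_mult powr_mult)
      also have "q * (a - b) = c - d" by (simp add: q algebra_simps)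
      finally show ?thesis by simp
    next
      case False
      then show ?thesis using picone_strict[OF p 3 nonneg(3,4)] by simp
    qed
  qed
qed

section \<open>Energy, its first variation, and the Laplacian\<close>

locale dirichlet_problem = weighted_graph G for G :: "'a wgraph" +
  fixes \<Omega> :: "'a set" and p :: real
  assumes domain_subset: "\<Omega> \<subseteq> verts G" and domain_nonempty: "\<Omega> \<noteq> {}"
    and domain_finite: "finite \<Omega>" and domain_connected: "induced_connected G \<Omega>"
    and p_gt_1: "1 < p"
begin

lemma adj_sym: "adj G x y \<longleftrightarrow> adj G y x"
  by (simp add: adj_def insert_commute)

lemma weight_sym: "weight G x y = weight G y x"
  by (simp add: weight_def adj_sym insert_commute adj_def)

lemma weight_nonneg: "weight G x y \<ge> 0"
  using emeas_pos by (auto simp: weight_def adj_def less_imp_le)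

lemma weight_pos: "adj G x y \<Longrightarrow> weight G x y > 0"
  using emeas_pos by (auto simp: weight_def adj_def)

text \<open>The closed neighbourhood of the domain: all sums over vertices live on this finite set.\<close>

definition nbhd :: "'a set" where
  "nbhd = \<Omega> \<union> (\<Union>x\<in>\<Omega>. {y \<in> verts G. adj G x y})"

lemma domain_nbhd: "\<Omega> \<subseteq> nbhd"
  by (auto simp: nbhd_def)

lemma nbhd_subset: "nbhd \<subseteq> verts G"
  using domain_subset by (auto simp: nbhd_def)

lemma finite_nbhd [simp]: "finite nbhd"
  using domain_finite domain_subset locally_finite by (auto simp: nbhd_def)

lemma adj_nbhd: "x \<in> \<Omega> \<Longrightarrow> adj G x y \<Longrightarrow> y \<in> nbhd"
  using edge_subset[of "{x, y}"] by (auto simp: nbhd_def adj_def)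

lemma p_laplacian_finite:
  assumes "x \<in> \<Omega>"
  shows "vmeas G x * p_laplacian G \<Omega> p u x
    = (\<Sum>y\<in>nbhd. weight G x y * signed_pow p (null_ext \<Omega> u y - null_ext \<Omega> u x))"
proof -
  have "(\<Sum>\<^sub>\<infinity>y\<in>verts G. weight G x y * signed_pow p (null_ext \<Omega> u y - null_ext \<Omega> u x))
    = (\<Sum>\<^sub>\<infinity>y\<in>nbhd. weight G x y * signed_pow p (null_ext \<Omega> u y - null_ext \<Omega> u x))"
    using adj_nbhd[OF assms] nbhd_subset
    by (intro infsum_cong_neutral) (auto simp: weight_def)
  moreover have "vmeas G x > 0" using assms domain_subset vmeas_pos by blast
  ultimately show ?thesis by (simp add: p_laplacian_def)
qed

lemma p_energy_finite:
  "p_energy G \<Omega> p u = 1 / 2 * (\<Sum>x\<in>nbhd. \<Sum>y\<in>nbhd.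
     weight G x y * \<bar>null_ext \<Omega> u y - null_ext \<Omega> u x\<bar> powr p)"
proof -
  define F where "F = (\<lambda>(x, y). \<bar>null_ext \<Omega> u y - null_ext \<Omega> u x\<bar> powr p * weight G x y)"
  have outside: "F z = 0" if z: "z \<in> {(x, y). x \<in> verts G \<and> y \<in> verts G \<and> adj G x y} - nbhd \<times> nbhd" for z
  proof -
    obtain x y where xy: "z = (x, y)" "adj G x y" "x \<notin> nbhd \<or> y \<notin> nbhd" using z by auto
    then have "x \<notin> \<Omega>" "y \<notin> \<Omega>"
      using adj_nbhd[of x y] adj_nbhd[of y x] domain_nbhd adj_sym by blast+
    then show ?thesis by (simp add: F_def xy null_ext_def)
  qed
  have inside: "F z = 0" if "z \<in> nbhd \<times> nbhd - {(x, y). x \<in> verts G \<and> y \<in> verts G \<and> adj G x y}" for z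
    using that nbhd_subset by (auto simp: F_def weight_def split: if_splits)
  have "infsum F {(x, y). x \<in> verts G \<and> y \<in> verts G \<and> adj G x y} = infsum F (nbhd \<times> nbhd)"
    by (rule infsum_cong_neutral[OF inside outside refl])
  also have "\<dots> = (\<Sum>(x, y)\<in>nbhd \<times> nbhd. weight G x y * \<bar>null_ext \<Omega> u y - null_ext \<Omega> u x\<bar> powr p)"
    by (simp add: F_def case_prod_unfold mult.commute)
  also have "\<dots> = (\<Sum>x\<in>nbhd. \<Sum>y\<in>nbhd. weight G x y * \<bar>null_ext \<Omega> u y - null_ext \<Omega> u x\<bar> powr p)"
    by (rule sum.cartesian_product[symmetric])
  finally show ?thesis unfolding p_energy_def F_def by simp
qed

text \<open>\<^term>\<open>p\<close> times the following is the derivative of the energy at \<^term>\<open>u\<close> in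
  direction \<^term>\<open>v\<close>.\<close>

definition energy_form :: "('a \<Rightarrow> real) \<Rightarrow> ('a \<Rightarrow> real) \<Rightarrow> real" where
  "energy_form u v = 1 / 2 * (\<Sum>x\<in>nbhd. \<Sum>y\<in>nbhd.
     weight G x y * (signed_pow p (null_ext \<Omega> u y - null_ext \<Omega> u x)
       * (null_ext \<Omega> v y - null_ext \<Omega> v x)))"

lemma energy_form_self: "energy_form u u = p_energy G \<Omega> p u"
  by (simp add: energy_form_def p_energy_finite signed_pow_mult_self)

lemma energy_form_deriv:
  "((\<lambda>t. p_energy G \<Omega> p (\<lambda>x. u x + t * v x)) has_real_derivative p * energy_form u v) (at 0)"
proof -
  define U where "U = (\<lambda>x y. null_ext \<Omega> u y - null_ext \<Omega> u x)"
  define V where "V = (\<lambda>x y. null_ext \<Omega> v y - null_ext \<Omega> v x)"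
  have "null_ext \<Omega> (\<lambda>x. u x + t * v x) y - null_ext \<Omega> (\<lambda>x. u x + t * v x) x = U x y + t * V x y"
    for t x y
    by (simp add: U_def V_def null_ext_def algebra_simps)
  then have energy: "p_energy G \<Omega> p (\<lambda>x. u x + t * v x) = 1 / 2 * (\<Sum>x\<in>nbhd. \<Sum>y\<in>nbhd.
     weight G x y * \<bar>U x y + t * V x y\<bar> powr p)" for t
    by (simp add: p_energy_finite)
  have "((\<lambda>t. \<bar>U x y + t * V x y\<bar> powr p) has_real_derivative p * signed_pow p (U x y) * V x y) (at 0)"
    for x y
    by (rule DERIV_chain2[where f = "\<lambda>s. \<bar>s\<bar> powr p"])
      (use has_real_derivative_abs_powr[OF p_gt_1, of "U x y"] in
        \<open>auto intro!: derivative_eq_intros\<close>)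
  then have "((\<lambda>t. p_energy G \<Omega> p (\<lambda>x. u x + t * v x)) has_real_derivative
    1 / 2 * (\<Sum>x\<in>nbhd. \<Sum>y\<in>nbhd. weight G x y * (p * signed_pow p (U x y) * V x y))) (at 0)"
    unfolding energy by (intro DERIV_cmult DERIV_sum)
  also have "1 / 2 * (\<Sum>x\<in>nbhd. \<Sum>y\<in>nbhd. weight G x y * (p * signed_pow p (U x y) * V x y))
    = p * energy_form u v"
    by (simp add: energy_form_def U_def V_def sum_distrib_left mult_ac)
  finally show ?thesis .
qed

text \<open>Green's formula. The coefficient of \<open>v y - v x\<close> is antisymmetric in \<open>x\<close> and \<open>y\<close>, so after
  exchanging the summations the parts with \<open>v y\<close> and \<open>- v x\<close> contribute equally.\<close>

lemma green:
  "energy_form u v = - (\<Sum>x\<in>\<Omega>. vmeas G x * p_laplacian G \<Omega> p u x * v x)"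
proof -
  define A where "A = (\<lambda>x y. weight G x y * signed_pow p (null_ext \<Omega> u y - null_ext \<Omega> u x))"
  define w where "w = null_ext \<Omega> v"
  have anti: "A y x = - A x y" for x y
    using signed_pow_minus[of p "null_ext \<Omega> u y - null_ext \<Omega> u x"]
    by (simp add: A_def weight_sym[of y x])
  have form: "energy_form u v = 1 / 2 * ((\<Sum>x\<in>nbhd. \<Sum>y\<in>nbhd. A x y * w y)
      - (\<Sum>x\<in>nbhd. \<Sum>y\<in>nbhd. A x y * w x))"
    by (simp add: energy_form_def A_def w_def right_diff_distrib sum_subtractf mult.assoc)
  have "(\<Sum>x\<in>nbhd. \<Sum>y\<in>nbhd. A x y * w y) = (\<Sum>x\<in>nbhd. \<Sum>y\<in>nbhd. A y x * w x)"
    by (rule sum.swap)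
  also have "\<dots> = (\<Sum>x\<in>nbhd. \<Sum>y\<in>nbhd. - (A x y * w x))"
    by (intro sum.cong refl, subst anti) simp
  also have "\<dots> = - (\<Sum>x\<in>nbhd. \<Sum>y\<in>nbhd. A x y * w x)"
    by (simp add: sum_negf)
  finally have "energy_form u v = - (\<Sum>x\<in>nbhd. \<Sum>y\<in>nbhd. A x y * w x)"
    unfolding form by simp
  also have "(\<Sum>x\<in>nbhd. \<Sum>y\<in>nbhd. A x y * w x) = (\<Sum>x\<in>\<Omega>. \<Sum>y\<in>nbhd. A x y * w x)"
    by (rule sum.mono_neutral_right) (use domain_nbhd in \<open>auto simp: w_def null_ext_def\<close>)
  also have "\<dots> = (\<Sum>x\<in>\<Omega>. vmeas G x * p_laplacian G \<Omega> p u x * v x)"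
    by (simp add: p_laplacian_finite A_def w_def null_ext_def sum_distrib_right)
  finally show ?thesis .
qed

lemma eigenfunction_weak:
  assumes "eigenfunction G \<Omega> p lam f"
  shows "energy_form f v = lam * (\<Sum>x\<in>\<Omega>. signed_pow p (f x) * v x * vmeas G x)"
  using assms by (simp add: green eigenfunction_def sum_distrib_left sum_negf[symmetric] mult_ac)

lemma eigenfunction_energy:
  assumes "eigenfunction G \<Omega> p lam f"
  shows "p_energy G \<Omega> p f = lam * p_norm_pow G \<Omega> p f"
  using eigenfunction_weak[OF assms, of f]
  by (simp add: energy_form_self signed_pow_mult_self p_norm_pow_def)

lemma null_ext_minus: "null_ext \<Omega> (\<lambda>x. - u x) y = - null_ext \<Omega> u y"
  by (simp add: null_ext_def)

lemma eigenfunction_minus: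
  assumes "eigenfunction G \<Omega> p lam f"
  shows "eigenfunction G \<Omega> p lam (\<lambda>x. - f x)"
proof -
  have "vmeas G x * p_laplacian G \<Omega> p (\<lambda>x. - f x) x = - (vmeas G x * p_laplacian G \<Omega> p f x)"
    if "x \<in> \<Omega>" for x
  proof -
    have "signed_pow p (null_ext \<Omega> f x - null_ext \<Omega> f y)
      = - signed_pow p (null_ext \<Omega> f y - null_ext \<Omega> f x)" for y
      using signed_pow_minus[of p "null_ext \<Omega> f y - null_ext \<Omega> f x"] by simp
    then show ?thesis
      using that by (simp add: p_laplacian_finite null_ext_minus sum_negf)
  qed
  then have "p_laplacian G \<Omega> p (\<lambda>x. - f x) x = - p_laplacian G \<Omega> p f x" if "x \<in> \<Omega>" for x
    using that vmeas_pos[of x] domain_subset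
    by (metis mult_cancel_left mult_minus_right order_less_irrefl subsetD)
  then show ?thesis using assms by (simp add: eigenfunction_def nonzero_on_def)
qed

section \<open>The variational characterisation of the first eigenvalue\<close>

lemma p_norm_pow_pos:
  assumes "nonzero_on \<Omega> u"
  shows "p_norm_pow G \<Omega> p u > 0"
proof -
  obtain x where x: "x \<in> \<Omega>" "u x \<noteq> 0" using assms by (auto simp: nonzero_on_def)
  have pos: "vmeas G y > 0" if "y \<in> \<Omega>" for y using that domain_subset vmeas_pos by blast
  show ?thesis unfolding p_norm_pow_def
    by (rule sum_pos2[OF domain_finite x(1)]) (use x pos pos[THEN less_imp_le] in auto)
qed

lemma p_energy_nonneg: "p_energy G \<Omega> p u \<ge> 0"
  unfolding p_energy_finite by (intro mult_nonneg_nonneg sum_nonneg) (auto simp: weight_nonneg)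

lemma first_eigenvalue_le:
  assumes "nonzero_on \<Omega> u"
  shows "first_eigenvalue G \<Omega> p * p_norm_pow G \<Omega> p u \<le> p_energy G \<Omega> p u"
proof -
  have "first_eigenvalue G \<Omega> p \<le> p_energy G \<Omega> p u / p_norm_pow G \<Omega> p u"
    unfolding first_eigenvalue_def
  proof (rule cINF_lower)
    show "bdd_below ((\<lambda>u. p_energy G \<Omega> p u / p_norm_pow G \<Omega> p u) ` {u. nonzero_on \<Omega> u})"
      using p_energy_nonneg p_norm_pow_pos by (intro bdd_belowI2[where m = 0]) (simp add: less_imp_le)
  qed (use assms in simp)
  then show ?thesis using p_norm_pow_pos[OF assms] by (simp add: pos_le_divide_eq)
qed

lemma first_eigenvalue_le_all:
  "first_eigenvalue G \<Omega> p * p_norm_pow G \<Omega> p u \<le> p_energy G \<Omega> p u"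
proof (cases "nonzero_on \<Omega> u")
  case False
  then have "p_norm_pow G \<Omega> p u = 0" by (simp add: nonzero_on_def p_norm_pow_def)
  then show ?thesis using p_energy_nonneg by simp
qed (rule first_eigenvalue_le)

lemma first_eigenvalue_ge:
  assumes "\<And>u. nonzero_on \<Omega> u \<Longrightarrow> lam * p_norm_pow G \<Omega> p u \<le> p_energy G \<Omega> p u"
  shows "lam \<le> first_eigenvalue G \<Omega> p"
  unfolding first_eigenvalue_def
proof (rule cINF_greatest)
  show "{u. nonzero_on \<Omega> u} \<noteq> {}"
    using domain_nonempty by (auto simp: nonzero_on_def intro!: exI[of _ "\<lambda>_. 1"])
qed (use assms p_norm_pow_pos in \<open>simp add: pos_le_divide_eq\<close>)

lemma p_norm_pow_deriv:
  "((\<lambda>t. p_norm_pow G \<Omega> p (\<lambda>x. u x + t * v x)) has_real_derivative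
     p * (\<Sum>x\<in>\<Omega>. signed_pow p (u x) * v x * vmeas G x)) (at 0)"
proof -
  have "((\<lambda>t. \<bar>u x + t * v x\<bar> powr p) has_real_derivative p * signed_pow p (u x) * v x) (at 0)" for x
    by (rule DERIV_chain2[where f = "\<lambda>s. \<bar>s\<bar> powr p"])
      (use has_real_derivative_abs_powr[OF p_gt_1, of "u x"] in
        \<open>auto intro!: derivative_eq_intros\<close>)
  then have "((\<lambda>t. p_norm_pow G \<Omega> p (\<lambda>x. u x + t * v x)) has_real_derivative
     (\<Sum>x\<in>\<Omega>. p * signed_pow p (u x) * v x * vmeas G x)) (at 0)"
    unfolding p_norm_pow_def by (intro DERIV_sum DERIV_cmult_right)
  then show ?thesis by (simp add: sum_distrib_left mult_ac)
qed

text \<open>The Euler--Lagrange equation: the nonnegative functional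
  \<open>p_energy - first_eigenvalue * p_norm_pow\<close> attains its minimum 0 at \<^term>\<open>h\<close>, so all its
  directional derivatives vanish there; the directions are the indicators of single vertices.\<close>

lemma minimizer_eigenfunction:
  assumes nz: "nonzero_on \<Omega> h"
    and min: "p_energy G \<Omega> p h = first_eigenvalue G \<Omega> p * p_norm_pow G \<Omega> p h"
  shows "first_eigenfunction G \<Omega> p h"
proof -
  let ?l = "first_eigenvalue G \<Omega> p"
  have "p_laplacian G \<Omega> p h z = - ?l * signed_pow p (h z)" if z: "z \<in> \<Omega>" for z
  proof -
    define v where "v = (\<lambda>x. if x = z then 1 else 0 :: real)"
    define J where "J = (\<lambda>t. p_energy G \<Omega> p (\<lambda>x. h x + t * v x)
      - ?l * p_norm_pow G \<Omega> p (\<lambda>x. h x + t * v x))"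
    have "(J has_real_derivative
        p * energy_form h v - ?l * (p * (\<Sum>x\<in>\<Omega>. signed_pow p (h x) * v x * vmeas G x))) (at 0)"
      unfolding J_def by (intro DERIV_diff DERIV_cmult energy_form_deriv p_norm_pow_deriv)
    moreover have "J 0 \<le> J t" for t
      using first_eigenvalue_le_all min by (simp add: J_def)
    ultimately have "p * energy_form h v
        - ?l * (p * (\<Sum>x\<in>\<Omega>. signed_pow p (h x) * v x * vmeas G x)) = 0"
      by (intro DERIV_local_min[of J _ 0 1]) auto
    then have "p * (energy_form h v - ?l * (\<Sum>x\<in>\<Omega>. signed_pow p (h x) * v x * vmeas G x)) = 0"
      by (simp add: algebra_simps)
    then have "energy_form h v = ?l * (\<Sum>x\<in>\<Omega>. signed_pow p (h x) * v x * vmeas G x)"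
      using p_gt_1 by simp
    moreover have "(\<Sum>x\<in>\<Omega>. signed_pow p (h x) * v x * vmeas G x) = signed_pow p (h z) * vmeas G z"
    proof -
      have "(\<Sum>x\<in>\<Omega>. signed_pow p (h x) * v x * vmeas G x)
        = (\<Sum>x\<in>\<Omega>. if x = z then signed_pow p (h x) * vmeas G x else 0)"
        by (intro sum.cong) (auto simp: v_def)
      then show ?thesis using z domain_finite by simp
    qed
    moreover have "energy_form h v = - (vmeas G z * p_laplacian G \<Omega> p h z)"
    proof -
      have "(\<Sum>x\<in>\<Omega>. vmeas G x * p_laplacian G \<Omega> p h x * v x)
        = (\<Sum>x\<in>\<Omega>. if x = z then vmeas G x * p_laplacian G \<Omega> p h x else 0)"
        by (intro sum.cong) (auto simp: v_def)
      then show ?thesis using z domain_finite by (simp add: green)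
    qed
    ultimately have "vmeas G z * p_laplacian G \<Omega> p h z = vmeas G z * (- ?l * signed_pow p (h z))"
      by (simp add: mult_ac)
    then show ?thesis using vmeas_pos[of z] z domain_subset
      by (metis mult_cancel_left order_less_irrefl subsetD)
  qed
  then show ?thesis using nz by (simp add: first_eigenfunction_def eigenfunction_def)
qed

section \<open>First eigenfunctions have one sign\<close>

lemma connected_induct:
  assumes "x0 \<in> \<Omega>" "P x0" "y \<in> \<Omega>"
    and step: "\<And>x y. x \<in> \<Omega> \<Longrightarrow> y \<in> \<Omega> \<Longrightarrow> adj G x y \<Longrightarrow> P x \<Longrightarrow> P y"
  shows "P y"
proof -
  have "(x0, y) \<in> {(a, b). a \<in> \<Omega> \<and> b \<in> \<Omega> \<and> adj G a b}\<^sup>*"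
    using domain_connected assms(1,3) by (simp add: induced_connected_def)
  then show ?thesis by induction (use assms(2) step in auto)
qed

text \<open>The strong minimum principle: at a zero of a nonnegative eigenfunction the equation says that
  a weighted sum of nonnegative terms, one for each neighbour, vanishes. Hence the zero set is
  closed under adjacency.\<close>

lemma nonneg_eigenfunction_pos:
  assumes eig: "eigenfunction G \<Omega> p lam h" and nonneg: "\<And>x. x \<in> \<Omega> \<Longrightarrow> h x \<ge> 0" and "x \<in> \<Omega>"
  shows "h x > 0"
proof (rule ccontr)
  assume "\<not> h x > 0"
  then have zero: "h x = 0" using nonneg[OF \<open>x \<in> \<Omega>\<close>] by simp
  have "h y = 0" if "y \<in> \<Omega>" for y
  proof (rule connected_induct[where P = "\<lambda>y. h y = 0", OF \<open>x \<in> \<Omega>\<close> zero that])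
    fix a b assume ab: "a \<in> \<Omega>" "b \<in> \<Omega>" "adj G a b" "h a = 0"
    have "p_laplacian G \<Omega> p h a = 0" using eig ab by (simp add: eigenfunction_def)
    then have "(\<Sum>y\<in>nbhd. weight G a y * signed_pow p (null_ext \<Omega> h y)) = 0"
      using p_laplacian_finite[OF ab(1), of h] ab by (simp add: null_ext_def)
    moreover have "weight G a y * signed_pow p (null_ext \<Omega> h y) \<ge> 0" for y
      using nonneg weight_nonneg by (auto simp: null_ext_def signed_pow_nonneg_eq)
    moreover have "b \<in> nbhd" using ab domain_nbhd by blast
    ultimately have "weight G a b * signed_pow p (h b) = 0"
      using ab(2) by (subst (asm) sum_nonneg_eq_0_iff) (auto simp: null_ext_def)
    then show "h b = 0" using weight_pos[OF ab(3)] by (auto simp: signed_pow_def)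
  qed
  then show False using eig by (auto simp: eigenfunction_def nonzero_on_def)
qed

lemma abs_null_ext: "null_ext \<Omega> (\<lambda>x. \<bar>u x\<bar>) y = \<bar>null_ext \<Omega> u y\<bar>"
  by (simp add: null_ext_def)

lemma energy_abs_term_le:
  "weight G x y * \<bar>null_ext \<Omega> (\<lambda>x. \<bar>u x\<bar>) y - null_ext \<Omega> (\<lambda>x. \<bar>u x\<bar>) x\<bar> powr p
   \<le> weight G x y * \<bar>null_ext \<Omega> u y - null_ext \<Omega> u x\<bar> powr p"
  unfolding abs_null_ext
  using p_gt_1 weight_nonneg by (intro mult_left_mono powr_mono2 abs_triangle_ineq3) auto

lemma p_energy_abs_le: "p_energy G \<Omega> p (\<lambda>x. \<bar>u x\<bar>) \<le> p_energy G \<Omega> p u"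
  unfolding p_energy_finite by (intro mult_left_mono sum_mono energy_abs_term_le) simp

text \<open>Since the energy of \<open>\<bar>u\<bar>\<close> is bounded by that of \<open>u\<close> term by term, equality of the sums is
  equality of all terms; and \<open>\<bar>\<bar>a\<bar> - \<bar>b\<bar>\<bar> = \<bar>a - b\<bar>\<close> fails for opposite signs.\<close>

lemma p_energy_abs_eq_imp_same_sign:
  assumes eq: "p_energy G \<Omega> p (\<lambda>x. \<bar>u x\<bar>) = p_energy G \<Omega> p u"
    and xy: "x \<in> \<Omega>" "y \<in> \<Omega>" "adj G x y"
  shows "u x * u y \<ge> 0"
proof -
  let ?F = "\<lambda>u x y. weight G x y * \<bar>null_ext \<Omega> u y - null_ext \<Omega> u x\<bar> powr p"
  have "(\<Sum>x\<in>nbhd. \<Sum>y\<in>nbhd. ?F (\<lambda>x. \<bar>u x\<bar>) x y) = (\<Sum>x\<in>nbhd. \<Sum>y\<in>nbhd. ?F u x y)"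
    using eq unfolding p_energy_finite by simp
  then have "(\<Sum>y\<in>nbhd. ?F (\<lambda>x. \<bar>u x\<bar>) x y) = (\<Sum>y\<in>nbhd. ?F u x y)"
    by (rule sum_mono_inv) (use xy domain_nbhd in \<open>auto intro!: sum_mono energy_abs_term_le\<close>)
  then have "?F (\<lambda>x. \<bar>u x\<bar>) x y = ?F u x y"
    by (rule sum_mono_inv) (use xy domain_nbhd in \<open>auto intro!: energy_abs_term_le\<close>)
  then have "\<bar>\<bar>u y\<bar> - \<bar>u x\<bar>\<bar> powr p = \<bar>u y - u x\<bar> powr p"
    using weight_pos[OF xy(3)] xy by (simp add: null_ext_def)
  then have "\<bar>\<bar>u y\<bar> - \<bar>u x\<bar>\<bar> = \<bar>u y - u x\<bar>"
    using p_gt_1 powr_less_mono2[of p "\<bar>\<bar>u y\<bar> - \<bar>u x\<bar>\<bar>" "\<bar>u y - u x\<bar>"]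
      abs_triangle_ineq3[of "u y" "u x"] by force
  then show ?thesis
    by (cases "u x \<ge> 0"; cases "u y \<ge> 0") (auto simp: zero_le_mult_iff abs_if split: if_splits)
qed

text \<open>Passing to absolute values keeps the norm and does not increase the energy, so \<open>\<bar>f\<bar>\<close> is again
  a minimizer, hence an eigenfunction, hence positive. Moreover the energies of \<open>f\<close> and \<open>\<bar>f\<bar>\<close>
  agree, which forbids a sign change along an edge.\<close>

lemma first_eigenfunction_sign:
  assumes "first_eigenfunction G \<Omega> p f"
  shows "(\<forall>x\<in>\<Omega>. f x > 0) \<or> (\<forall>x\<in>\<Omega>. f x < 0)"
proof -
  let ?l = "first_eigenvalue G \<Omega> p"
  have eig: "eigenfunction G \<Omega> p ?l f" using assms by (simp add: first_eigenfunction_def)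
  have nz: "nonzero_on \<Omega> (\<lambda>x. \<bar>f x\<bar>)"
    using eig by (simp add: eigenfunction_def nonzero_on_def)
  have norm: "p_norm_pow G \<Omega> p (\<lambda>x. \<bar>f x\<bar>) = p_norm_pow G \<Omega> p f"
    by (simp add: p_norm_pow_def)
  have eq: "p_energy G \<Omega> p (\<lambda>x. \<bar>f x\<bar>) = p_energy G \<Omega> p f"
    using p_energy_abs_le[of f] first_eigenvalue_le[OF nz] eigenfunction_energy[OF eig] norm
    by simp
  then have "first_eigenfunction G \<Omega> p (\<lambda>x. \<bar>f x\<bar>)"
    using minimizer_eigenfunction[OF nz] eigenfunction_energy[OF eig] norm by simp
  then have "\<bar>f x\<bar> > 0" if "x \<in> \<Omega>" for x
    using nonneg_eigenfunction_pos[of ?l "\<lambda>x. \<bar>f x\<bar>"] that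
    by (simp add: first_eigenfunction_def)
  then have nonzero: "f x \<noteq> 0" if "x \<in> \<Omega>" for x using that by auto
  obtain x0 where x0: "x0 \<in> \<Omega>" using domain_nonempty by blast
  have "f x0 * f y > 0" if "y \<in> \<Omega>" for y
  proof (rule connected_induct[OF x0 _ that])
    show "f x0 * f x0 > 0" using nonzero[OF x0] by (auto simp: zero_less_mult_iff)
    fix x y assume xy: "x \<in> \<Omega>" "y \<in> \<Omega>" "adj G x y" "f x0 * f x > 0"
    then show "f x0 * f y > 0"
      using p_energy_abs_eq_imp_same_sign[OF eq xy(1-3)] nonzero[OF xy(2)]
      by (auto simp: zero_less_mult_iff zero_le_mult_iff)
  qed
  then show ?thesis
    by (cases "f x0 > 0") (auto simp: zero_less_mult_iff)
qed

section \<open>Positive eigenfunctions are first and unique\<close>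

lemma picone_term:
  assumes "\<And>x. x \<in> \<Omega> \<Longrightarrow> f x > 0" "\<And>x. x \<in> \<Omega> \<Longrightarrow> u x \<ge> 0"
  shows "weight G x y * (signed_pow p (null_ext \<Omega> f y - null_ext \<Omega> f x)
      * (null_ext \<Omega> (\<lambda>x. u x powr p / f x powr (p - 1)) y
         - null_ext \<Omega> (\<lambda>x. u x powr p / f x powr (p - 1)) x))
    \<le> weight G x y * \<bar>null_ext \<Omega> u y - null_ext \<Omega> u x\<bar> powr p"
proof -
  have v: "null_ext \<Omega> (\<lambda>x. u x powr p / f x powr (p - 1)) z
    = null_ext \<Omega> u z powr p / null_ext \<Omega> f z powr (p - 1)" for z
    by (simp add: null_ext_def)
  have "null_ext \<Omega> f z \<ge> 0" "null_ext \<Omega> u z \<ge> 0" "null_ext \<Omega> f z = 0 \<Longrightarrow> null_ext \<Omega> u z = 0" for z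
    using assms(1)[of z] assms(2)[of z] by (auto simp: null_ext_def split: if_splits)
  then show ?thesis
    unfolding v using weight_nonneg p_gt_1 by (intro mult_left_mono picone)
qed

lemma picone_energy:
  assumes "\<And>x. x \<in> \<Omega> \<Longrightarrow> f x > 0" "\<And>x. x \<in> \<Omega> \<Longrightarrow> u x \<ge> 0"
  shows "energy_form f (\<lambda>x. u x powr p / f x powr (p - 1)) \<le> p_energy G \<Omega> p u"
  unfolding p_energy_finite energy_form_def
  by (intro mult_left_mono sum_mono picone_term assms) simp_all

lemma picone_energy_eq:
  assumes pos: "\<And>x. x \<in> \<Omega> \<Longrightarrow> f x > 0" "\<And>x. x \<in> \<Omega> \<Longrightarrow> u x \<ge> 0"
    and eq: "energy_form f (\<lambda>x. u x powr p / f x powr (p - 1)) = p_energy G \<Omega> p u"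
    and xy: "x \<in> \<Omega>" "y \<in> \<Omega>" "adj G x y"
  shows "u y * f x = u x * f y"
proof (rule ccontr)
  assume ne: "u y * f x \<noteq> u x * f y"
  let ?v = "\<lambda>x. u x powr p / f x powr (p - 1)"
  let ?F = "\<lambda>x y. weight G x y * (signed_pow p (null_ext \<Omega> f y - null_ext \<Omega> f x)
      * (null_ext \<Omega> ?v y - null_ext \<Omega> ?v x))"
  let ?K = "\<lambda>x y. weight G x y * \<bar>null_ext \<Omega> u y - null_ext \<Omega> u x\<bar> powr p"
  have le: "?F x y \<le> ?K x y" for x y by (rule picone_term[OF pos])
  have "(\<Sum>x\<in>nbhd. \<Sum>y\<in>nbhd. ?F x y) = (\<Sum>x\<in>nbhd. \<Sum>y\<in>nbhd. ?K x y)"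
    using eq unfolding p_energy_finite energy_form_def by simp
  then have "(\<Sum>y\<in>nbhd. ?F x y) = (\<Sum>y\<in>nbhd. ?K x y)"
    by (rule sum_mono_inv) (use xy domain_nbhd in \<open>auto intro!: sum_mono le\<close>)
  then have "?F x y = ?K x y"
    by (rule sum_mono_inv) (use xy domain_nbhd in \<open>auto intro!: le\<close>)
  then have "signed_pow p (f y - f x) * (?v y - ?v x) = \<bar>u y - u x\<bar> powr p"
    using weight_pos[OF xy(3)] xy by (simp add: null_ext_def)
  then show False
    using picone_strict[OF p_gt_1 pos(1)[OF xy(2)] pos(1)[OF xy(1)] pos(2)[OF xy(2)] pos(2)[OF xy(1)] ne]
    by simp
qed

text \<open>The Picone test function is chosen so that testing the equation for \<^term>\<open>f\<close> with it produces
  the norm of \<^term>\<open>u\<close>.\<close>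

lemma eigenfunction_picone_test:
  assumes "eigenfunction G \<Omega> p lam f"
    and pos: "\<And>x. x \<in> \<Omega> \<Longrightarrow> f x > 0" and nonneg: "\<And>x. x \<in> \<Omega> \<Longrightarrow> u x \<ge> 0"
  shows "energy_form f (\<lambda>x. u x powr p / f x powr (p - 1)) = lam * p_norm_pow G \<Omega> p u"
proof -
  have "signed_pow p (f x) * (u x powr p / f x powr (p - 1)) = \<bar>u x\<bar> powr p" if "x \<in> \<Omega>" for x
    using pos[OF that] nonneg[OF that] by (simp add: signed_pow_nonneg_eq)
  then show ?thesis
    unfolding eigenfunction_weak[OF assms(1)] p_norm_pow_def by (simp cong: sum.cong)
qed

text \<open>Minimality of \<^term>\<open>lam\<close>: Picone's inequality bounds the Rayleigh quotient of every nonnegative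
  function from below by \<^term>\<open>lam\<close>, and arbitrary \<open>u\<close> reduce to \<open>\<bar>u\<bar>\<close>.\<close>

lemma positive_eigenfunction_first:
  assumes eig: "eigenfunction G \<Omega> p lam f" and pos: "\<And>x. x \<in> \<Omega> \<Longrightarrow> f x > 0"
  shows "first_eigenfunction G \<Omega> p f"
proof -
  have "lam \<le> first_eigenvalue G \<Omega> p"
  proof (rule first_eigenvalue_ge)
    fix u
    have "lam * p_norm_pow G \<Omega> p u = lam * p_norm_pow G \<Omega> p (\<lambda>x. \<bar>u x\<bar>)"
      by (simp add: p_norm_pow_def)
    also have "\<dots> \<le> p_energy G \<Omega> p (\<lambda>x. \<bar>u x\<bar>)"
      using eigenfunction_picone_test[OF eig pos, where u = "\<lambda>x. \<bar>u x\<bar>"]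
        picone_energy[where f = f and u = "\<lambda>x. \<bar>u x\<bar>"] pos by simp
    also have "\<dots> \<le> p_energy G \<Omega> p u" by (rule p_energy_abs_le)
    finally show "lam * p_norm_pow G \<Omega> p u \<le> p_energy G \<Omega> p u" .
  qed
  moreover have "first_eigenvalue G \<Omega> p \<le> lam"
  proof -
    have nz: "nonzero_on \<Omega> f" using eig by (simp add: eigenfunction_def)
    show ?thesis
      using first_eigenvalue_le[OF nz] eigenfunction_energy[OF eig] p_norm_pow_pos[OF nz] by simp
  qed
  ultimately show ?thesis using eig by (simp add: first_eigenfunction_def)
qed

text \<open>For two positive first eigenfunctions Picone's inequality is an equality, which makes
  \<open>g / f\<close> constant along edges.\<close>

lemma positive_first_eigenfunctions_proportional:
  assumes f: "first_eigenfunction G \<Omega> p f" "\<And>x. x \<in> \<Omega> \<Longrightarrow> f x > 0"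
    and g: "first_eigenfunction G \<Omega> p g" "\<And>x. x \<in> \<Omega> \<Longrightarrow> g x > 0"
  shows "\<exists>c. \<forall>x\<in>\<Omega>. g x = c * f x"
proof -
  have g': "g x \<ge> 0" if "x \<in> \<Omega>" for x using g(2)[OF that] by simp
  have eq: "energy_form f (\<lambda>x. g x powr p / f x powr (p - 1)) = p_energy G \<Omega> p g"
    using eigenfunction_picone_test[of _ f g] eigenfunction_energy[of _ g] f g g'
    by (simp add: first_eigenfunction_def)
  have edge: "g y * f x = g x * f y" if "x \<in> \<Omega>" "y \<in> \<Omega>" "adj G x y" for x y
    using picone_energy_eq[OF f(2) g' eq that] by simp
  obtain x0 where x0: "x0 \<in> \<Omega>" using domain_nonempty by blast
  have "g y = g x0 / f x0 * f y" if "y \<in> \<Omega>" for y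
  proof (rule connected_induct[OF x0 _ that])
    show "g x0 = g x0 / f x0 * f x0" using f(2)[OF x0] by simp
    fix x y assume xy: "x \<in> \<Omega>" "y \<in> \<Omega>" "adj G x y" "g x = g x0 / f x0 * f x"
    have "f x * g y = f x * (g x0 / f x0 * f y)"
      using edge[OF xy(1-3)] xy(4) by (simp add: mult_ac)
    then show "g y = g x0 / f x0 * f y"
      using f(2)[OF xy(1)] by (subst (asm) mult_cancel_left) simp
  qed
  then show ?thesis by blast
qed

lemma eigenfunction_first_iff_sign:
  assumes "eigenfunction G \<Omega> p lam f"
  shows "first_eigenfunction G \<Omega> p f \<longleftrightarrow> (\<forall>x\<in>\<Omega>. f x > 0) \<or> (\<forall>x\<in>\<Omega>. f x < 0)"
proof
  assume "(\<forall>x\<in>\<Omega>. f x > 0) \<or> (\<forall>x\<in>\<Omega>. f x < 0)"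
  then show "first_eigenfunction G \<Omega> p f"
  proof
    assume "\<forall>x\<in>\<Omega>. f x > 0"
    then show ?thesis using positive_eigenfunction_first[OF assms] by blast
  next
    assume "\<forall>x\<in>\<Omega>. f x < 0"
    then have "first_eigenfunction G \<Omega> p (\<lambda>x. - f x)"
      using positive_eigenfunction_first[OF eigenfunction_minus[OF assms]] by simp
    then show ?thesis
      using eigenfunction_minus[of _ "\<lambda>x. - f x"] by (simp add: first_eigenfunction_def)
  qed
qed (rule first_eigenfunction_sign)

lemma first_eigenfunction_unique:
  assumes f: "first_eigenfunction G \<Omega> p f" and g: "first_eigenfunction G \<Omega> p g"
  shows "\<exists>c. \<forall>x\<in>\<Omega>. g x = c * f x"
proof -
  have normalize: "\<exists>s. s * s = 1 \<and> first_eigenfunction G \<Omega> p (\<lambda>x. s * h x) \<and> (\<forall>x\<in>\<Omega>. s * h x > 0)"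
    if h: "first_eigenfunction G \<Omega> p h" for h
    using first_eigenfunction_sign[OF h]
  proof
    assume "\<forall>x\<in>\<Omega>. h x > 0"
    then show ?thesis using h by (intro exI[of _ 1]) simp
  next
    assume "\<forall>x\<in>\<Omega>. h x < 0"
    then show ?thesis using h eigenfunction_minus
      by (intro exI[of _ "- 1"]) (simp add: first_eigenfunction_def)
  qed
  obtain s where s: "first_eigenfunction G \<Omega> p (\<lambda>x. s * f x)" "\<forall>x\<in>\<Omega>. s * f x > 0"
    using normalize[OF f] by blast
  obtain t where t: "t * t = 1" "first_eigenfunction G \<Omega> p (\<lambda>x. t * g x)" "\<forall>x\<in>\<Omega>. t * g x > 0"
    using normalize[OF g] by blast
  obtain c where c: "\<forall>x\<in>\<Omega>. t * g x = c * (s * f x)"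
    using positive_first_eigenfunctions_proportional[OF s(1) _ t(2)] s(2) t(3) by blast
  have "g x = t * c * s * f x" if "x \<in> \<Omega>" for x
  proof -
    have "g x = t * (t * g x)" using t(1) by (simp flip: mult.assoc)
    then show ?thesis using c that by (simp add: mult_ac)
  qed
  then show ?thesis by blast
qed

end

section \<open>Characterisation and uniqueness of first eigenfunctions\<close>

theorem theorem1p1:
  fixes G :: "'a wgraph" and \<Omega> :: "'a set" and p :: real
  assumes "weighted_graph G"
    and "\<Omega> \<subseteq> verts G" and "\<Omega> \<noteq> {}" and "finite \<Omega>" and "induced_connected G \<Omega>"
    and "1 < p"
  shows "(\<forall>f. (\<exists>lam. eigenfunction G \<Omega> p lam f) \<longrightarrow>
            (first_eigenfunction G \<Omega> p f \<longleftrightarrow> (\<forall>x\<in>\<Omega>. f x > 0) \<or> (\<forall>x\<in>\<Omega>. f x < 0)))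
       \<and> (\<forall>f g. first_eigenfunction G \<Omega> p f \<longrightarrow> first_eigenfunction G \<Omega> p g \<longrightarrow>
            (\<exists>c. \<forall>x\<in>\<Omega>. g x = c * f x))"
proof -
  interpret dirichlet_problem G \<Omega> p
    using assms by (intro dirichlet_problem.intro dirichlet_problem_axioms.intro)
  show ?thesis
    using eigenfunction_first_iff_sign first_eigenfunction_unique by blast
qed

end
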